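(* Let $a,b$ be integers such that $x^7+ax+b$ is irreducible over $\mathbb{Q}$, let $\theta$ be a root of this polynomial and $K=\mathbb{Q}(\theta)$. Then $K$ is non-monogenic if one of the following holds: (1) $a\equiv 5\pmod 9$ and $b\equiv 3\pmod 9$. (2) $a\equiv 5\pmod 9$ and $b\equiv 6\pmod 9$.
   Context: A number field $K$ of degree $n$ with ring of integers $\mathbb{O}_K$ is monogenic if there is $\alpha\in\mathbb{O}_K$ such that $\{1,\alpha,\dots,\alpha^{n-1}\}$ is a $\mathbb{Z}$-basis of $\mathbb{O}_K$ (i.e. $\mathbb{O}_K=\mathbb{Z}[\alpha]$); otherwise it is non-monogenic. *)

theory Defs
  imports "HOL-Computational_Algebra.Polynomial" "HOL-Number_Theory.Cong"
begin

text \<open>Fields are treated as subsets of an arbitrary ambient field type of characteristic zero.\<close>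

definition is_subfield :: "'a::field_char_0 set \<Rightarrow> bool" where
  "is_subfield K \<longleftrightarrow>
     0 \<in> K \<and> 1 \<in> K \<and>
     (\<forall>x\<in>K. \<forall>y\<in>K. x + y \<in> K \<and> x * y \<in> K) \<and>
     (\<forall>x\<in>K. - x \<in> K \<and> inverse x \<in> K)"

text \<open>Every subfield contains the prime field, so the smallest subfield containing \<open>\<theta>\<close>
  is \<open>\<rat>(\<theta>)\<close>.\<close>

definition rat_adjoin :: "'a::field_char_0 \<Rightarrow> 'a set" where
  "rat_adjoin \<theta> = is_subfield hull {\<theta>}"

definition ring_of_integers :: "'a::field_char_0 set \<Rightarrow> 'a set" where
  "ring_of_integers K = {x \<in> K. algebraic_int x}"

abbreviation rat_scale :: "rat \<Rightarrow> 'a::field_char_0 \<Rightarrow> 'a" where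
  "rat_scale q x \<equiv> of_rat q * x"

lemma vector_space_rat_scale: "vector_space (rat_scale :: rat \<Rightarrow> 'a \<Rightarrow> 'a::field_char_0)"
  by unfold_locales (simp_all add: algebra_simps of_rat_add of_rat_mult)

text \<open>The degree over \<open>\<rat>\<close>; as usual for \<open>dim\<close>, it is \<open>0\<close> if there is no finite basis.\<close>

definition field_degree :: "'a::field_char_0 set \<Rightarrow> nat" where
  "field_degree K = vector_space.dim rat_scale K"

definition is_int_basis :: "nat \<Rightarrow> (nat \<Rightarrow> 'a::field_char_0) \<Rightarrow> 'a set \<Rightarrow> bool" where
  "is_int_basis n v M \<longleftrightarrow>
     M = range (\<lambda>c :: nat \<Rightarrow> int. \<Sum>i<n. of_int (c i) * v i) \<and>
     (\<forall>c :: nat \<Rightarrow> int. (\<Sum>i<n. of_int (c i) * v i) = 0 \<longrightarrow> (\<forall>i<n. c i = 0))"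

definition monogenic :: "'a::field_char_0 set \<Rightarrow> bool" where
  "monogenic K \<longleftrightarrow>
     (\<exists>\<alpha>\<in>ring_of_integers K.
        is_int_basis (field_degree K) (\<lambda>i. \<alpha> ^ i) (ring_of_integers K))"

end

theory Submission
  imports Defs "HOL-Computational_Algebra.Polynomial_Factorial"
    "HOL-Computational_Algebra.Field_as_Ring"
begin

text \<open>
  The prime 3 is a common index divisor. Modulo 3 the polynomial is \<open>x (x - 1)\<^sup>3 (x + 1)\<^sup>3\<close>. Replacing
  \<open>\<theta>\<close> by \<open>-\<theta>\<close> if necessary we may assume \<open>b \<equiv> 3\<close> modulo 9. The Newton polygon at \<open>-1\<close> is then one
  segment of slope \<open>-1/3\<close>, while the one at \<open>1\<close> has a side of length 1 and a side of slope
  \<open>-1/2\<close>; the two primes above \<open>\<theta> \<mapsto> 1\<close> are separated by \<open>\<beta> = h(\<theta>)/3\<close>, where \<open>h\<close> is the quotient of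
  the polynomial by \<open>x - 1\<close>. Hence the ring of integers has four homomorphisms to the field with three
  elements, given by \<open>(\<theta>, \<beta>) \<mapsto> (0, 0), (-1, 0), (1, 0), (1, 1)\<close>, whereas \<open>\<int>[\<alpha>]\<close> has at most three,
  since they are determined by the image of \<open>\<alpha>\<close>. Each homomorphism is first defined on \<open>\<int>[\<theta>, \<beta>]\<close>
  and extends to all integral elements because the localization at its kernel is a
  discrete valuation ring.
\<close>

section \<open>Evaluation of integer polynomials in the ambient field\<close>

abbreviation ipoly :: "int poly \<Rightarrow> 'a::field_char_0 \<Rightarrow> 'a" where
  "ipoly p x \<equiv> poly (map_poly of_int p) x"

lemma map_poly_hom_add:
  assumes "f 0 = 0" "\<And>x y. f (x + y) = f x + f y"
  shows "map_poly f (p + q) = map_poly f p + map_poly f q"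
  by (rule poly_eqI) (simp add: coeff_map_poly assms)

lemma map_poly_hom_mult:
  fixes f :: "'b::comm_semiring_0 \<Rightarrow> 'c::comm_semiring_0"
  assumes f0: "f 0 = 0" and fa: "\<And>x y. f (x + y) = f x + f y" and fm: "\<And>x y. f (x * y) = f x * f y"
  shows "map_poly f (p * q) = map_poly f p * map_poly f q"
proof (induction p)
  case (pCons a p)
  show ?case
    by (simp add: mult_pCons_left map_poly_pCons map_poly_smult map_poly_hom_add[OF f0 fa]
        pCons.IH f0 fm)
qed simp

lemma ipoly_add: "ipoly (p + q) x = ipoly p x + ipoly q x"
  by (simp add: map_poly_hom_add)

lemma ipoly_mult: "ipoly (p * q) x = ipoly p x * ipoly q x"
  by (simp add: map_poly_hom_mult)

lemma ipoly_uminus: "ipoly (- p) x = - ipoly p x"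
  using ipoly_add[of p "- p" x] by (simp add: eq_neg_iff_add_eq_0 add.commute)

lemma ipoly_diff: "ipoly (p - q) x = ipoly p x - ipoly q x"
  using ipoly_add[of p "- q" x] by (simp add: ipoly_uminus)

lemma ipoly_pCons: "ipoly (pCons c p) x = of_int c + x * ipoly p x"
  by (simp add: map_poly_pCons)

lemma ipoly_smult: "ipoly (smult c p) x = of_int c * ipoly p x"
  by (simp add: map_poly_smult)

lemma ipoly_sum_monom: "ipoly (\<Sum>i<n. monom (c i) i) x = (\<Sum>i<n. of_int (c i) * x ^ i)"
  by (induction n) (simp_all add: ipoly_add map_poly_monom poly_monom)

subsection \<open>Residue maps\<close>

text \<open>
  A ring homomorphism from a subring of the ambient field to \<open>\<int>/p\<close>, encoded by the relation
  \<open>\<rho> x n\<close>: the element \<open>x\<close> lies in the subring and is mapped to the class of \<open>n\<close>.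
\<close>

locale residue_relation =
  fixes p :: int and \<rho> :: "'a::field_char_0 \<Rightarrow> int \<Rightarrow> bool"
  assumes prime: "prime p"
    and of_int: "\<rho> (of_int n) n"
    and add: "\<rho> x m \<Longrightarrow> \<rho> y n \<Longrightarrow> \<rho> (x + y) (m + n)"
    and mult: "\<rho> x m \<Longrightarrow> \<rho> y n \<Longrightarrow> \<rho> (x * y) (m * n)"
    and cong: "\<rho> x m \<Longrightarrow> [m = n] (mod p) \<Longrightarrow> \<rho> x n"
    and zero: "\<rho> 0 n \<Longrightarrow> p dvd n"
begin

lemma uminus: "\<rho> x m \<Longrightarrow> \<rho> (- x) (- m)"
  using mult[OF of_int[of "-1"], of x m] by simp

lemma diff: "\<rho> x m \<Longrightarrow> \<rho> y n \<Longrightarrow> \<rho> (x - y) (m - n)"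
  using add[OF _ uminus] by fastforce

lemma unique: "\<rho> x m \<Longrightarrow> \<rho> x n \<Longrightarrow> [m = n] (mod p)"
  using zero[of "m - n"] diff[of x m x n] by (simp add: cong_iff_dvd_diff)

lemma power: "\<rho> x m \<Longrightarrow> \<rho> (x ^ k) (m ^ k)"
  by (induction k) (use of_int[of 1] mult in auto)

lemma ipoly: "\<rho> x m \<Longrightarrow> \<rho> (ipoly q x) (poly q m)"
  by (induction q) (use of_int[of 0] in \<open>auto simp: ipoly_pCons intro!: add of_int mult\<close>)

text \<open>This is the localization at the kernel of \<open>\<rho>\<close>: \<open>s\<close> is a
  denominator outside the kernel and \<open>s * z\<close> the numerator. Writing the numerator's
  residue as \<open>m * n\<close> avoids division modulo \<open>p\<close>.\<close>

definition loc :: "'a \<Rightarrow> int \<Rightarrow> bool" where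
  "loc z n \<longleftrightarrow> (\<exists>s m. \<rho> s m \<and> \<not> p dvd m \<and> \<rho> (s * z) (m * n))"

lemma locI: "\<rho> z n \<Longrightarrow> loc z n"
  unfolding loc_def using of_int[of 1] prime
  by (intro exI[of _ 1]) (auto dest: not_prime_unit)

lemma residue_relation_loc: "residue_relation p loc"
proof
  show "prime p" by (fact prime)
  show "loc (of_int n) n" for n by (intro locI of_int)
  fix x m
  assume "loc x m"
  then obtain s i where s: "\<rho> s i" "\<not> p dvd i" "\<rho> (s * x) (i * m)"
    by (auto simp: loc_def)
  show "loc x n" if "[m = n] (mod p)" for n
    unfolding loc_def using s(1,2) cong[OF s(3) cong_scalar_left[OF that]] by blast
  fix y n
  assume "loc y n"
  then obtain t j where t: "\<rho> t j" "\<not> p dvd j" "\<rho> (t * y) (j * n)"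
    by (auto simp: loc_def)
  have st: "\<rho> (s * t) (i * j)" "\<not> p dvd i * j"
    using mult[OF s(1) t(1)] s(2) t(2) prime by (simp_all add: prime_dvd_mult_iff)
  have "\<rho> (t * (s * x) + s * (t * y)) (j * (i * m) + i * (j * n))"
    by (rule add[OF mult[OF t(1) s(3)] mult[OF s(1) t(3)]])
  then show "loc (x + y) (m + n)"
    unfolding loc_def using st by (intro exI[of _ "s * t"] exI[of _ "i * j"]) (simp add: algebra_simps)
  have "\<rho> ((s * x) * (t * y)) ((i * m) * (j * n))"
    by (rule mult[OF s(3) t(3)])
  then show "loc (x * y) (m * n)"
    unfolding loc_def using st by (intro exI[of _ "s * t"] exI[of _ "i * j"]) (simp add: algebra_simps)
next
  show "p dvd n" if n: "loc 0 n" for n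
  proof -
    obtain s m where "\<rho> s m" "\<not> p dvd m" "\<rho> 0 (m * n)"
      using n unfolding loc_def mult_zero_right by blast
    then show ?thesis
      using zero[of "m * n"] prime by (simp add: prime_dvd_mult_iff)
  qed
qed

text \<open>The numerator \<open>s * x\<close> has residue \<open>i * n\<close>, a unit modulo
  \<open>p\<close>, so it can serve as a denominator of \<open>inverse x\<close>, with numerator
  \<open>s\<close>.\<close>

lemma loc_inverse:
  assumes "loc x n" "\<not> p dvd n"
  obtains k where "loc (inverse x) k"
proof -
  obtain s i where s: "\<rho> s i" "\<not> p dvd i" "\<rho> (s * x) (i * n)"
    using assms by (auto simp: loc_def)
  have "x \<noteq> 0"
    using assms residue_relation.zero[OF residue_relation_loc] by blast
  obtain k where k: "[n * k = 1] (mod p)"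
    using assms(2) prime cong_solve_coprime_int[of n p]
    by (metis coprime_commute prime_imp_coprime)
  have "[i = i * n * k] (mod p)"
    using cong_scalar_left[OF k, of i] by (simp add: cong_sym mult.assoc)
  then have "\<rho> (s * x * inverse x) (i * n * k)"
    using cong[OF s(1)] \<open>x \<noteq> 0\<close> by (simp add: mult.assoc)
  moreover have "\<not> p dvd i * n"
    using s assms prime by (simp add: prime_dvd_mult_iff)
  ultimately have "loc (inverse x) k"
    unfolding loc_def using s(3) by blast
  then show ?thesis by (rule that)
qed

end

section \<open>Extending residues to integral elements\<close>

locale local_residue_relation = residue_relation +
  assumes inverse: "\<rho> x n \<Longrightarrow> \<not> p dvd n \<Longrightarrow> \<exists>k. \<rho> (inverse x) k"
begin

text \<open>
  Here \<open>\<pi>\<close> generates the kernel of \<open>\<rho>\<close>. If \<open>j\<close> is least such that \<open>\<pi> ^ j * z\<close> has a residue, and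
  \<open>j > 0\<close>, then this residue is nonzero, but \<open>\<pi> ^ (j * N)\<close> times an integral equation of degree
  \<open>N\<close> for \<open>z\<close> shows that its \<open>N\<close>-th power is zero.
\<close>

lemma algebraic_int_has_residue:
  assumes \<pi>: "\<pi> \<noteq> 0" "\<rho> \<pi> 0"
    and principal: "\<And>x n. \<rho> x n \<Longrightarrow> p dvd n \<Longrightarrow> \<exists>k. \<rho> (x / \<pi>) k"
    and ramification: "\<rho> (\<pi> ^ e / of_int p) l"
    and z: "algebraic_int z" "n \<noteq> 0" "\<rho> (of_int n * z) k"
  shows "\<exists>k. \<rho> z k"
proof -
  define P where "P = (\<lambda>j. \<exists>k. \<rho> (\<pi> ^ j * z) k)"
  obtain m where m: "n = p ^ multiplicity p n * m" "\<not> p dvd m"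
    using multiplicity_decompose'[of n p] z(2) prime
    by (metis not_prime_unit mult.commute)
  define v where "v = multiplicity p n"
  have p0: "p \<noteq> 0" "m \<noteq> 0" using prime m by auto
  obtain i where i: "\<rho> (inverse (of_int m)) i"
    using inverse[OF of_int m(2)] by blast
  \<comment> \<open>The power of \<open>p\<close> in the denominator \<open>n\<close> is absorbed by
    \<open>\<pi> ^ (e * v)\<close>, and the cofactor \<open>m\<close> is a unit. So some power of
    \<open>\<pi>\<close> times \<open>z\<close> has a residue, and a least one exists.\<close>
  have eq: "\<pi> ^ (e * v) * z = (\<pi> ^ e / of_int p) ^ v * (inverse (of_int m) * (of_int n * z))"
    using p0 by (subst m(1), fold v_def) (simp add: field_simps power_mult)
  have "\<rho> (\<pi> ^ (e * v) * z) (l ^ v * (i * k))"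
    unfolding eq by (rule mult[OF power[OF ramification] mult[OF i z(3)]])
  then have "P (e * v)"
    unfolding P_def by (rule exI)
  define j where "j = (LEAST j. P j)"
  have "P j" unfolding j_def using \<open>P (e * v)\<close> by (rule LeastI)
  show ?thesis
  proof (cases j)
    case 0
    then show ?thesis using \<open>P j\<close> by (simp add: P_def)
  next
    case (Suc j')
    define r where "r = \<pi> ^ j * z"
    obtain t where t: "\<rho> r t" using \<open>P j\<close> by (auto simp: P_def r_def)
    obtain q where q: "ipoly q z = 0" "lead_coeff q = 1"
      using z(1) by (auto simp: algebraic_int_altdef_ipoly)
    define N where "N = degree q"
    have deg: "degree (map_poly of_int q :: 'a poly) = N"
      unfolding N_def by (rule degree_map_poly) auto
    have "0 = \<pi> ^ (j * N) * ipoly q z"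
      using q by simp
    also have "\<dots> = (\<Sum>i\<le>N. of_int (coeff q i) * (\<pi> ^ (j * N) * z ^ i))"
      unfolding poly_altdef deg by (simp add: sum_distrib_left coeff_map_poly algebra_simps)
    also have "\<dots> = (\<Sum>i\<le>N. of_int (coeff q i) * (\<pi> ^ (j * (N - i)) * r ^ i))"
    proof (intro sum.cong refl)
      fix i assume "i \<in> {..N}"
      then have "j * N = j * (N - i) + j * i"
        by (simp add: add_mult_distrib2[symmetric])
      then show "of_int (coeff q i) * (\<pi> ^ (j * N) * z ^ i) =
          of_int (coeff q i) * (\<pi> ^ (j * (N - i)) * r ^ i)"
        by (simp only: r_def power_mult_distrib power_add power_mult mult.assoc)
    qed
    also have "\<dots> = r ^ N + (\<Sum>i<N. of_int (coeff q i) * (\<pi> ^ (j * (N - i)) * r ^ i))"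
      using q(2) by (simp add: lessThan_Suc_atMost[symmetric] N_def)
    finally have eq: "0 = r ^ N + (\<Sum>i<N. of_int (coeff q i) * (\<pi> ^ (j * (N - i)) * r ^ i))" .
    \<comment> \<open>Each index \<open>i < N\<close> leaves a positive exponent
      \<open>j * (N - i)\<close>, so every lower term contains a factor \<open>\<pi>\<close> and has
      residue 0.\<close>
    have "\<rho> (\<Sum>i<M. of_int (coeff q i) * (\<pi> ^ (j * (N - i)) * r ^ i)) 0" if "M \<le> N" for M
      using that
    proof (induction M)
      case 0
      then show ?case using of_int[of 0] by simp
    next
      case (Suc M)
      then have "\<rho> (\<pi> ^ (j * (N - M))) 0"
        using power[OF \<pi>(2), of "j * (N - M)"] \<open>j = Suc j'\<close> by (simp add: power_0_left)
      from mult[OF of_int[of "coeff q M"] mult[OF this power[OF t, of M]]]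
      show ?case using add[OF Suc.IH] Suc.prems by fastforce
    qed
    from add[OF power[OF t, of N] this[OF order_refl]] have "\<rho> 0 (t ^ N)"
      by (simp only: eq[symmetric] add_0_right)
    then have "p dvd t"
      using zero prime prime_dvd_power by blast
    with principal[OF t] obtain k where "\<rho> (r / \<pi>) k" by blast
    moreover have "r / \<pi> = \<pi> ^ j' * z"
      using \<pi>(1) by (simp add: r_def Suc)
    ultimately have "P j'" by (auto simp: P_def)
    then have "j \<le> j'" unfolding j_def by (rule Least_le)
    then show ?thesis using Suc by simp
  qed
qed

end

lemma (in residue_relation) local_residue_relation_loc: "local_residue_relation p loc"
proof -
  interpret L: residue_relation p loc by (fact residue_relation_loc)
  show ?thesis by unfold_locales (use loc_inverse in blast)
qed

text \<open>By the pigeonhole principle two of the maps agree at \<open>\<alpha>\<close> modulo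
  \<open>p\<close>, hence on all of \<int>[\<alpha>]. An element that separates these two maps
  therefore lies outside \<int>[\<alpha>].\<close>

lemma too_many_residue_relations:
  fixes \<rho> :: "'i \<Rightarrow> 'a::field_char_0 \<Rightarrow> int \<Rightarrow> bool"
  assumes p: "prime p" "p < int (card I)"
    and \<rho>: "\<And>i. i \<in> I \<Longrightarrow> residue_relation p (\<rho> i)"
    and total: "\<And>i. i \<in> I \<Longrightarrow> \<exists>k. \<rho> i \<alpha> k"
    and sep: "\<And>i j. i \<in> I \<Longrightarrow> j \<in> I \<Longrightarrow> i \<noteq> j \<Longrightarrow> \<exists>z\<in>R. \<forall>k. \<not> (\<rho> i z k \<and> \<rho> j z k)"
  shows "\<exists>z\<in>R. \<forall>q. z \<noteq> ipoly q \<alpha>"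
proof -
  obtain k where k: "\<And>i. i \<in> I \<Longrightarrow> \<rho> i \<alpha> (k i)"
    using total by metis
  have "(\<lambda>i. k i mod p) ` I \<subseteq> {0..<p}"
    using prime_gt_0_int[OF p(1)] by auto
  then have "card ((\<lambda>i. k i mod p) ` I) \<le> nat p"
    using card_mono[of "{0..<p}"] by fastforce
  then have "\<not> inj_on (\<lambda>i. k i mod p) I"
    using p(2) prime_gt_0_int[OF p(1)] by (intro pigeonhole) linarith
  then obtain i j where ij: "i \<in> I" "j \<in> I" "i \<noteq> j" "[k j = k i] (mod p)"
    unfolding inj_on_def cong_def by metis
  obtain z where z: "z \<in> R" "\<And>l. \<not> (\<rho> i z l \<and> \<rho> j z l)"
    using sep[OF ij(1-3)] by blast
  have "\<rho> j \<alpha> (k i)"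
    using residue_relation.cong[OF \<rho>[OF ij(2)] k[OF ij(2)] ij(4)] .
  then have "\<rho> j (ipoly q \<alpha>) (poly q (k i))" "\<rho> i (ipoly q \<alpha>) (poly q (k i))" for q
    using residue_relation.ipoly[OF \<rho>[OF ij(2)]] residue_relation.ipoly[OF \<rho>[OF ij(1)] k[OF ij(1)]]
    by blast+
  then have "z \<noteq> ipoly q \<alpha>" for q using z(2) by metis
  then show ?thesis using z(1) by blast
qed

text \<open>The homomorphism \<open>\<int>[\<eta>, \<beta>] \<rightarrow> \<int>/p\<close> with \<open>\<eta> \<mapsto> t\<close> and \<open>\<beta> \<mapsto> s\<close>, for \<open>\<beta>\<close> quadratic over \<open>\<int>[\<eta>]\<close>.\<close>

definition pair_relation :: "int \<Rightarrow> 'a::field_char_0 \<Rightarrow> 'a \<Rightarrow> int \<Rightarrow> int \<Rightarrow> 'a \<Rightarrow> int \<Rightarrow> bool" where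
  "pair_relation p \<eta> \<beta> t s x n \<longleftrightarrow>
     (\<exists>P Q. x = ipoly P \<eta> + ipoly Q \<eta> * \<beta> \<and> [n = poly P t + poly Q t * s] (mod p))"

text \<open>\<open>quadratic\<close> closes \<int>[\<eta>] + \<int>[\<eta>]\<beta> under
  multiplication, \<open>quadratic_residue\<close> makes the assignment multiplicative, and
  \<open>well_defined\<close> makes it independent of the representation.\<close>

locale pair_residue =
  fixes p :: int and \<eta> \<beta> :: "'a::field_char_0" and A B :: "int poly" and t s :: int
  assumes prime: "prime p"
    and quadratic: "\<beta> * \<beta> = ipoly A \<eta> * \<beta> + ipoly B \<eta>"
    and quadratic_residue: "[s * s = poly A t * s + poly B t] (mod p)"
    and well_defined: "ipoly P \<eta> + ipoly Q \<eta> * \<beta> = 0 \<Longrightarrow> p dvd poly P t + poly Q t * s"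

sublocale pair_residue \<subseteq> residue_relation p "pair_relation p \<eta> \<beta> t s"
proof
  show "prime p" by (fact prime)
  show "pair_relation p \<eta> \<beta> t s (of_int n) n" for n
    unfolding pair_relation_def by (rule exI[of _ "[:n:]"], rule exI[of _ 0]) (simp add: map_poly_pCons)
  show "p dvd n" if "pair_relation p \<eta> \<beta> t s 0 n" for n
    using that well_defined unfolding pair_relation_def by (metis cong_dvd_iff)
  fix x m
  assume "pair_relation p \<eta> \<beta> t s x m"
  then obtain P Q where x: "x = ipoly P \<eta> + ipoly Q \<eta> * \<beta>" "[m = poly P t + poly Q t * s] (mod p)"
    unfolding pair_relation_def by blast
  show "pair_relation p \<eta> \<beta> t s x n" if "[m = n] (mod p)" for n
    unfolding pair_relation_def using x(1) cong_trans[OF cong_sym[OF that] x(2)] by blast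
  fix y n
  assume "pair_relation p \<eta> \<beta> t s y n"
  then obtain P' Q' where y: "y = ipoly P' \<eta> + ipoly Q' \<eta> * \<beta>" "[n = poly P' t + poly Q' t * s] (mod p)"
    unfolding pair_relation_def by blast
  show "pair_relation p \<eta> \<beta> t s (x + y) (m + n)"
    unfolding pair_relation_def
    using cong_add[OF x(2) y(2)]
    by (intro exI[of _ "P + P'"] exI[of _ "Q + Q'"]) (simp add: x(1) y(1) ipoly_add algebra_simps)
  have "x * y = ipoly P \<eta> * ipoly P' \<eta> + (ipoly P \<eta> * ipoly Q' \<eta> + ipoly Q \<eta> * ipoly P' \<eta>) * \<beta>
      + ipoly Q \<eta> * ipoly Q' \<eta> * (\<beta> * \<beta>)"
    unfolding x y by (simp add: algebra_simps)
  also have "\<dots> = ipoly (P * P' + Q * Q' * B) \<eta> + ipoly (P * Q' + Q * P' + Q * Q' * A) \<eta> * \<beta>"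
    unfolding quadratic by (simp add: ipoly_add ipoly_mult algebra_simps)
  finally have eq: "x * y = \<dots>" .
  have "[m * n = (poly P t + poly Q t * s) * (poly P' t + poly Q' t * s)] (mod p)"
    using x y by (intro cong_mult)
  also have "(poly P t + poly Q t * s) * (poly P' t + poly Q' t * s) =
     poly P t * poly P' t + (poly P t * poly Q' t + poly Q t * poly P' t) * s
      + poly Q t * poly Q' t * (s * s)"
    by (simp add: algebra_simps)
  also have "[\<dots> = poly P t * poly P' t + (poly P t * poly Q' t + poly Q t * poly P' t) * s
      + poly Q t * poly Q' t * (poly A t * s + poly B t)] (mod p)"
    by (intro cong_add cong_mult cong_refl quadratic_residue)
  finally show "pair_relation p \<eta> \<beta> t s (x * y) (m * n)"
    unfolding pair_relation_def eq
    by (intro exI[of _ "P * P' + Q * Q' * B"] exI[of _ "P * Q' + Q * P' + Q * Q' * A"])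
      (simp add: algebra_simps)
qed

section \<open>The localization of \<int>[\<eta>, \<beta>] at a residue map\<close>

context pair_residue
begin

sublocale loc: local_residue_relation p loc
  by (fact local_residue_relation_loc)

definition V where "V = {x. \<exists>k. loc x k}"

lemma V_closed [simp, intro]:
  "x \<in> V \<Longrightarrow> y \<in> V \<Longrightarrow> x + y \<in> V" "x \<in> V \<Longrightarrow> y \<in> V \<Longrightarrow> x - y \<in> V"
  "x \<in> V \<Longrightarrow> y \<in> V \<Longrightarrow> x * y \<in> V" "x \<in> V \<Longrightarrow> - x \<in> V" "of_int n \<in> V"
  unfolding V_def using loc.add loc.diff loc.mult loc.uminus loc.of_int by blast+

lemma V_divide: "x \<in> V \<Longrightarrow> loc y n \<Longrightarrow> \<not> p dvd n \<Longrightarrow> x / y \<in> V"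
  unfolding divide_inverse using loc.inverse[of y n] V_closed(3)[of x "inverse y"] by (auto simp: V_def)

lemma loc_nonzero: "loc y n \<Longrightarrow> \<not> p dvd n \<Longrightarrow> y \<noteq> 0"
  using loc.zero by auto

lemma loc_gen: "loc \<eta> t" "loc \<beta> s" "loc (ipoly P \<eta>) (poly P t)"
proof -
  show \<eta>: "loc \<eta> t"
    by (rule locI, unfold pair_relation_def, rule exI[of _ "[:0,1:]"], rule exI[of _ 0])
      (simp add: map_poly_pCons)
  show "loc \<beta> s"
    by (rule locI, unfold pair_relation_def, rule exI[of _ 0], rule exI[of _ 1])
      simp
  show "loc (ipoly P \<eta>) (poly P t)" by (rule loc.ipoly[OF \<eta>])
qed

lemma V_gen [simp, intro]: "ipoly P \<eta> \<in> V" "\<eta> \<in> V" "\<beta> \<in> V"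
  using loc_gen unfolding V_def by blast+

text \<open>The kernel is generated by \<open>\<eta> - t\<close>, \<open>\<beta> - s\<close> and
  \<open>p\<close>, so once \<open>\<pi>\<close> divides these three in \<open>V\<close>, the
  maximal ideal of \<open>V\<close> is principal.\<close>

lemma algebraic_int_has_residue:
  assumes \<pi>: "\<pi> \<noteq> 0" "loc \<pi> 0"
    and gens: "(\<eta> - of_int t) / \<pi> \<in> V" "(\<beta> - of_int s) / \<pi> \<in> V" "of_int p / \<pi> \<in> V"
    and ramification: "\<pi> ^ e / of_int p \<in> V"
    and z: "algebraic_int z" "n \<noteq> 0" "of_int n * z = ipoly q \<eta>"
  shows "\<exists>k. loc z k"
proof -
  obtain l where l: "loc (\<pi> ^ e / of_int p) l"
    using ramification by (auto simp: V_def)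
  have z': "loc (of_int n * z) (poly q t)"
    using loc_gen z(3) by simp
  have P: "(ipoly P \<eta> - of_int (poly P t)) / \<pi> \<in> V" for P
  proof -
    have "poly (P - [:poly P t:]) t = 0" by simp
    then obtain P1 where "P - [:poly P t:] = [:- t, 1:] * P1"
      unfolding poly_eq_0_iff_dvd by (auto elim: dvdE)
    then have "ipoly (P - [:poly P t:]) \<eta> = ipoly ([:- t, 1:] * P1) \<eta>" by simp
    then have "(ipoly P \<eta> - of_int (poly P t)) / \<pi> = ((\<eta> - of_int t) / \<pi>) * ipoly P1 \<eta>"
      by (simp add: ipoly_diff ipoly_mult map_poly_pCons del: mult_pCons_left)
    then show ?thesis using gens(1) by (simp only: V_closed V_gen)
  qed
  have "\<exists>k. loc (x / \<pi>) k" if x: "loc x m" "p dvd m" for x m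
  proof -
    obtain r i where r: "pair_relation p \<eta> \<beta> t s r i" "\<not> p dvd i"
      "pair_relation p \<eta> \<beta> t s (r * x) (i * m)"
      using x(1) by (auto simp: loc_def)
    then obtain P Q where PQ: "r * x = ipoly P \<eta> + ipoly Q \<eta> * \<beta>"
      "[i * m = poly P t + poly Q t * s] (mod p)"
      unfolding pair_relation_def by blast
    have "p dvd poly P t + poly Q t * s"
      using PQ(2) x(2) by (metis cong_dvd_iff dvd_mult)
    then obtain j where j: "poly P t + poly Q t * s = p * j" ..
    \<comment> \<open>Expanding the numerator around the point \<open>(t, s)\<close> makes every
      term a multiple of one of the three generators.\<close>
    have "r * x = (ipoly P \<eta> - of_int (poly P t)) + (ipoly Q \<eta> - of_int (poly Q t)) * \<beta>
        + of_int (poly Q t) * (\<beta> - of_int s) + of_int (p * j)"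
      unfolding PQ(1) j[symmetric] by (simp add: algebra_simps)
    then have "r * x / \<pi> = (ipoly P \<eta> - of_int (poly P t)) / \<pi>
        + (ipoly Q \<eta> - of_int (poly Q t)) / \<pi> * \<beta>
        + of_int (poly Q t) * ((\<beta> - of_int s) / \<pi>) + of_int p / \<pi> * of_int j"
      by (simp add: add_divide_distrib)
    then have "r * x / \<pi> \<in> V"
      using P gens by (simp only: V_closed V_gen)
    then have "r * x / \<pi> / r \<in> V"
      using V_divide locI r by blast
    then show ?thesis
      using loc_nonzero[OF locI] r by (auto simp: V_def)
  qed
  from loc.algebraic_int_has_residue[OF \<pi> this l z(1,2) z'] show ?thesis .
qed

end

subsection \<open>The four residue maps at 3\<close>

text \<open>
  The coefficients \<open>a = 9 * g - 4\<close> and \<open>b = 9 * (c - g) + 3\<close> are chosen such that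
  \<open>f(1) = 1 + a + b = 9 * c\<close> and \<open>f'(1) = 7 + a = 3 * (3 * g + 1)\<close>.
\<close>

locale septic =
  fixes c g :: int and \<eta> :: "'a::field_char_0"
  assumes root: "\<eta> ^ 7 + of_int (9 * g - 4) * \<eta> + of_int (9 * (c - g) + 3) = 0"
    and minimal: "ipoly P \<eta> = 0 \<Longrightarrow> [:9 * (c - g) + 3, 9 * g - 4, 0, 0, 0, 0, 0, 1:] dvd P"
begin

text \<open>
  \<open>h\<close> is the quotient of \<open>f\<close> by \<open>x - 1\<close>, and \<open>u\<close> is the quotient of \<open>f\<close> by \<open>(x - 1)\<^sup>3\<close>.
\<close>

definition h :: "int poly" where "h = [:9 * g - 3, 1, 1, 1, 1, 1, 1:]"
definition u :: "int poly" where "u = [:15, 10, 6, 3, 1:]"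
definition \<beta> :: 'a where "\<beta> = ipoly h \<eta> / 3"

lemma f_eq: "[:9 * (c - g) + 3, 9 * g - 4, 0, 0, 0, 0, 0, 1:] = [:-1, 1:] * h + [:9 * c:]"
  by (simp add: h_def)

lemma beta_mult: "(\<eta> - 1) * \<beta> = - 3 * of_int c"
proof -
  have "(\<eta> - 1) * ipoly h \<eta> = - 9 * of_int c"
    using root unfolding h_def by (simp add: map_poly_pCons algebra_simps power_numeral_reduce)
  then show ?thesis unfolding \<beta>_def by (simp add: field_simps)
qed

text \<open>This is the Taylor expansion of \<open>h\<close> at 1, with
  \<open>h(1) = 3 * (3 * g + 1)\<close> and \<open>h'(1) = 21\<close>.\<close>

lemma beta_eq: "3 * (\<beta> - of_int (3 * g + 1) - 7 * (\<eta> - 1)) = (\<eta> - 1)\<^sup>2 * ipoly u \<eta>"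
proof -
  have "3 * \<beta> = ipoly h \<eta>" by (simp add: \<beta>_def)
  then show ?thesis
    unfolding h_def u_def by (simp add: map_poly_pCons algebra_simps power_numeral_reduce)
qed

text \<open>Multiplying \<open>beta_eq\<close> by \<open>\<beta>\<close> trades one factor
  \<open>\<eta> - 1\<close> for \<open>- 3 * c\<close>, and the 3 cancels. Modulo 3 and
  \<open>\<eta> - 1\<close> it reads \<open>\<beta> * (\<beta> - 1) = 0\<close>, which yields the
  two points above \<open>\<eta> = 1\<close>.\<close>

lemma beta_factor:
  "\<beta> * (\<beta> - of_int (3 * g + 1) - 7 * (\<eta> - 1)) = - of_int c * (\<eta> - 1) * ipoly u \<eta>"
proof -
  have "3 * (\<beta> * (\<beta> - of_int (3 * g + 1) - 7 * (\<eta> - 1))) = 3 * (- of_int c * (\<eta> - 1) * ipoly u \<eta>)"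
    using beta_mult beta_eq by algebra
  then show ?thesis by simp
qed

text \<open>When \<open>beta_factor\<close> is expanded, \<open>beta_mult\<close> turns the mixed
  term \<open>7 * (\<eta> - 1) * \<beta>\<close> into \<open>- 21 * c\<close>.\<close>

lemma beta_quadratic:
  "\<beta> * \<beta> = ipoly [:3 * g + 1:] \<eta> * \<beta> + ipoly (smult (- c) ([:21:] + [:-1, 1:] * u)) \<eta>"
proof -
  have "ipoly (smult (- c) ([:21:] + [:-1, 1:] * u)) \<eta> =
      - of_int c * (21 + (\<eta> - 1) * ipoly u \<eta>)"
    by (simp add: ipoly_add ipoly_mult ipoly_smult ipoly_uminus map_poly_pCons del: mult_pCons_left)
  moreover have "\<beta> * \<beta> = of_int (3 * g + 1) * \<beta> - of_int c * (21 + (\<eta> - 1) * ipoly u \<eta>)"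
    using beta_mult beta_factor by algebra
  ultimately show ?thesis by (simp add: map_poly_pCons)
qed

section \<open>Integrality of \<open>\<eta>\<close> and \<open>\<beta>\<close>\<close>

lemma algebraic_int_eta: "algebraic_int \<eta>"
  unfolding algebraic_int_altdef_ipoly
  using root
  by (intro exI[of _ "[:9 * (c - g) + 3, 9 * g - 4, 0, 0, 0, 0, 0, 1:]"])
    (simp add: map_poly_pCons algebra_simps power_numeral_reduce)

lemma linear_nonzero: "\<eta> + of_int k \<noteq> 0"
proof
  assume "\<eta> + of_int k = 0"
  then have "ipoly [:k, 1:] \<eta> = 0" by (simp add: map_poly_pCons add.commute)
  from dvd_imp_degree_le[OF minimal[OF this]] show False by simp
qed

lemma algebraic_int_beta: "algebraic_int \<beta>"
proof (cases "c = 0")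
  case True
  then have "\<beta> = 0" using beta_mult linear_nonzero[of "-1"] by simp
  then show ?thesis by simp
next
  case False
  \<comment> \<open>obtained by substituting \<open>y = - 3 * c / \<beta>\<close> into the equation of \<open>y = \<eta> - 1\<close>\<close>
  define q :: "int poly" where
    "q = [:- 243 * c ^ 6, 567 * c ^ 5, - 567 * c ^ 4, 315 * c ^ 3, - 105 * c\<^sup>2, 21 * c,
      - (3 * g + 1), 1:]"
  define C G where "C = (of_int c :: 'a)" and "G = (of_int g :: 'a)"
  have q: "ipoly q \<beta> = \<beta> ^ 7 - (3 * G + 1) * \<beta> ^ 6 + 21 * C * \<beta> ^ 5 - 105 * C\<^sup>2 * \<beta> ^ 4
      + 315 * C ^ 3 * \<beta> ^ 3 - 567 * C ^ 4 * \<beta>\<^sup>2 + 567 * C ^ 5 * \<beta> - 243 * C ^ 6"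
    unfolding q_def by (simp add: map_poly_pCons C_def G_def algebra_simps power_numeral_reduce)
  define y where "y = \<eta> - 1"
  have "y ^ 7 + 7 * y ^ 6 + 21 * y ^ 5 + 35 * y ^ 4 + 35 * y ^ 3 + 21 * y\<^sup>2
      + 3 * (3 * G + 1) * y + 9 * C = 0"
    using root unfolding y_def C_def G_def by (simp add: algebra_simps power_numeral_reduce)
  moreover have "y * \<beta> = - 3 * C" using beta_mult by (simp add: y_def C_def)
  \<comment> \<open>After multiplication by \<open>\<beta> ^ 7\<close> every \<open>y\<close> can be
    paired with a \<open>\<beta>\<close>; replacing \<open>y * \<beta>\<close> by
    \<open>- 3 * C\<close> leaves a common factor \<open>9 * C\<close>.\<close>
  moreover have "\<beta> ^ 7 * (y ^ 7 + 7 * y ^ 6 + 21 * y ^ 5 + 35 * y ^ 4 + 35 * y ^ 3 + 21 * y\<^sup>2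
        + 3 * (3 * G + 1) * y + 9 * C) =
      (y * \<beta>) ^ 7 + 7 * \<beta> * (y * \<beta>) ^ 6 + 21 * \<beta>\<^sup>2 * (y * \<beta>) ^ 5 + 35 * \<beta> ^ 3 * (y * \<beta>) ^ 4
      + 35 * \<beta> ^ 4 * (y * \<beta>) ^ 3 + 21 * \<beta> ^ 5 * (y * \<beta>)\<^sup>2 + 3 * (3 * G + 1) * \<beta> ^ 6 * (y * \<beta>)
      + 9 * C * \<beta> ^ 7"
    by (simp add: algebra_simps power_numeral_reduce)
  ultimately have "9 * C * ipoly q \<beta> = 0"
    unfolding q by (simp add: algebra_simps power_numeral_reduce)
  then have "ipoly q \<beta> = 0" using False by (simp add: C_def)
  then show ?thesis
    unfolding algebraic_int_altdef_ipoly by (intro exI[of _ q]) (simp add: q_def)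
qed

text \<open>All relations between 1 and \<open>\<beta>\<close> over \<int>[\<eta>] follow from
  \<open>(\<eta> - 1) * \<beta> + 3 * c = 0\<close> and \<open>3 * \<beta> - h(\<eta>) = 0\<close>.
  The first two assumptions say that both survive modulo 3 at \<open>(t, s)\<close>; the third does
  so for the quadratic equation.\<close>

lemma pair_residue:
  assumes "3 dvd poly h t" "3 dvd (t - 1) * s"
    and "[s * s = (3 * g + 1) * s - c * (21 + (t - 1) * poly u t)] (mod 3)"
  shows "pair_residue 3 \<eta> \<beta> [:3 * g + 1:] (smult (- c) ([:21:] + [:-1, 1:] * u)) t s"
proof
  show "prime (3::int)" by simp
  show "\<beta> * \<beta> = ipoly [:3 * g + 1:] \<eta> * \<beta> + ipoly (smult (- c) ([:21:] + [:-1, 1:] * u)) \<eta>"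
    by (fact beta_quadratic)
  show "[s * s = poly [:3 * g + 1:] t * s + poly (smult (- c) ([:21:] + [:-1, 1:] * u)) t] (mod 3)"
    using assms(3) by (simp add: algebra_simps)
  fix P Q assume PQ: "ipoly P \<eta> + ipoly Q \<eta> * \<beta> = 0"
  have "ipoly ([:3:] * P + Q * h) \<eta> = 3 * (ipoly P \<eta> + ipoly Q \<eta> * \<beta>)"
    by (simp add: ipoly_add ipoly_mult ipoly_smult map_poly_pCons \<beta>_def algebra_simps del: mult_pCons_left)
  then have "[:9 * (c - g) + 3, 9 * g - 4, 0, 0, 0, 0, 0, 1:] dvd [:3:] * P + Q * h"
    by (intro minimal) (simp add: PQ)
  then obtain r where r: "[:3:] * P + Q * h = ([:-1, 1:] * h + [:9 * c:]) * r"
    unfolding f_eq by (elim dvdE)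
  have nine: "[:9 * c:] = [:3:] * [:3 * c:]" by simp
  have "(Q - [:-1, 1:] * r) * h = [:3:] * ([:3 * c:] * r - P)"
    using r unfolding nine by algebra
  then have "[:3:] dvd (Q - [:-1, 1:] * r) * h" by (rule dvdI)
  \<comment> \<open>By Gauss's lemma 3 stays prime in \<int>[x], and \<open>h\<close> has a
    coefficient 1, so 3 must divide the other factor.\<close>
  moreover have "prime_elem [:3::int:]"
    by (intro lift_prime_elem_poly) simp
  moreover have "\<not> [:3:] dvd h"
    unfolding const_poly_dvd_iff by (auto simp: h_def intro!: exI[of _ 1])
  ultimately have "[:3:] dvd Q - [:-1, 1:] * r"
    using prime_elem_dvd_multD by blast
  then obtain k where k: "Q - [:-1, 1:] * r = [:3:] * k" by (elim dvdE)
  have "[:3:] * P = [:3:] * ([:3 * c:] * r - k * h)"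
    using r k unfolding nine by algebra
  then have P: "P = [:3 * c:] * r - k * h"
    using mult_left_cancel[of "[:3::int:]"] by (simp del: mult_pCons_left)
  have Q: "Q = [:-1, 1:] * r + [:3:] * k" using k by algebra
  have "poly P t + poly Q t * s = 3 * (c * poly r t + poly k t * s) - poly k t * poly h t
      + poly r t * ((t - 1) * s)"
    unfolding P Q by (simp add: algebra_simps)
  then show "3 dvd poly P t + poly Q t * s"
    using assms by (simp add: dvd_add dvd_diff)
qed

abbreviation residue :: "int \<Rightarrow> int \<Rightarrow> 'a \<Rightarrow> int \<Rightarrow> bool" where
  "residue t s \<equiv> residue_relation.loc 3 (pair_relation 3 \<eta> \<beta> t s)"

text \<open>The divisions of \<open>f\<close> by \<open>(x + 1)\<^sup>3\<close>, \<open>x + 1\<close> and \<open>x\<close>, evaluated at \<open>\<eta>\<close>.\<close>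

lemma minus_one_eq:
  "(\<eta> + 1) ^ 3 * ipoly [:15, -10, 6, -3, 1:] \<eta> =
    - 3 * (of_int (2 + 3 * c - 6 * g) - 7 * (\<eta> + 1)\<^sup>2 + of_int (3 * g + 1) * (\<eta> + 1))"
  "(\<eta> + 1) * ipoly [:9 * g - 3, -1, 1, -1, 1, -1, 1:] \<eta> = - 3 * of_int (2 + 3 * c - 6 * g)"
  using root by (simp_all add: map_poly_pCons algebra_simps power_numeral_reduce)

lemma zero_eq: "\<eta> * ipoly [:9 * g - 4, 0, 0, 0, 0, 0, 1:] \<eta> = - 3 * of_int (3 * (c - g) + 1)"
  using root by (simp add: map_poly_pCons algebra_simps power_numeral_reduce)

text \<open>
  The uniformizers at the four points are \<open>3\<close>, \<open>\<eta> + 1\<close>, \<open>\<eta> - 1\<close> and \<open>3\<close>, with ramification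
  indices 1, 3, 2 and 1.
\<close>

lemma
  assumes "(t, s) \<in> {(0, 0), (- 1, 0), (1, 0), (1, 1)}"
  shows residue_relation_point: "residue_relation 3 (residue t s)"
    and residue_eta: "residue t s \<eta> t"
    and residue_beta: "residue t s \<beta> s"
    and residue_exists: "algebraic_int z \<Longrightarrow> n \<noteq> 0 \<Longrightarrow> of_int n * z = ipoly q \<eta> \<Longrightarrow> \<exists>k. residue t s z k"
proof -
  interpret pair_residue 3 \<eta> \<beta> "[:3 * g + 1:]" "smult (- c) ([:21:] + [:-1, 1:] * u)" t s
    using assms
    by (intro pair_residue) (auto simp: h_def u_def cong_iff_dvd_diff)
  show "residue_relation 3 (residue t s)" by (fact residue_relation_loc)
  show "residue t s \<eta> t" "residue t s \<beta> s" by (fact loc_gen)+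
  have one: "1 \<in> V" using V_closed(5)[of 1] by simp
  have residue_shift: "loc (\<eta> + of_int k) (t + k)" for k
    by (intro loc.add loc_gen loc.of_int)
  have E: "loc (\<beta> - of_int (3 * g + 1) - 7 * (\<eta> - 1)) (s - (3 * g + 1) - 7 * (t - 1))"
    using loc.diff[OF loc.diff[OF loc_gen(2) loc.of_int[of "3 * g + 1"]]
        loc.mult[OF loc.of_int[of 7] loc.diff[OF loc_gen(1) loc.of_int[of 1]]]] by simp
  have nz: "\<eta> + 1 \<noteq> 0" "\<eta> - 1 \<noteq> 0"
    using linear_nonzero[of 1] linear_nonzero[of "-1"] by simp_all
  show "\<exists>k. residue t s z k" if z: "algebraic_int z" "n \<noteq> 0" "of_int n * z = ipoly q \<eta>"
    using assms
  proof (elim insertE emptyE)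
    assume "(t, s) = (0, 0)"
    then have ts: "t = 0" "s = 0" by auto
    \<comment> \<open>Both \<open>w\<close> and \<open>\<eta> - 1\<close> are units here, so
      \<open>zero_eq\<close> and \<open>beta_mult\<close> make \<open>\<eta>\<close> and
      \<open>\<beta>\<close> multiples of 3.\<close>
    define w where "w = ipoly [:9 * g - 4, 0, 0, 0, 0, 0, 1:] \<eta>"
    have w: "loc w (9 * g - 4)"
      unfolding w_def using loc_gen(3)[of "[:9 * g - 4, 0, 0, 0, 0, 0, 1:]"] ts by simp
    have w1: "\<not> 3 dvd 9 * g - 4" by presburger
    have w2: "w \<noteq> 0" by (rule loc_nonzero[OF w w1])
    have y: "loc (\<eta> - 1) (- 1)" using residue_shift[of "-1"] ts by simp
    have y1: "\<not> 3 dvd (- 1 :: int)" by simp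
    have "\<eta> / 3 = of_int (- (3 * (c - g) + 1)) / w"
      using zero_eq w2 unfolding w_def[symmetric] by (simp add: field_simps)
    moreover have "\<beta> / 3 = of_int (- c) / (\<eta> - 1)"
      using beta_mult nz by (simp add: field_simps)
    ultimately have "\<eta> / 3 \<in> V" "\<beta> / 3 \<in> V"
      using V_divide[OF V_closed(5) w w1] V_divide[OF V_closed(5) y y1] by (simp_all only:)
    moreover have "loc 3 0"
      using loc.cong[OF loc.of_int[of 3], of 0] by (simp add: cong_def)
    ultimately show ?thesis
      using algebraic_int_has_residue[of 3 1, OF _ _ _ _ _ _ z] one ts by simp
  next
    assume "(t, s) = (- 1, 0)"
    then have ts: "t = -1" "s = 0" by auto
    \<comment> \<open>\<open>m\<close> is \<open>f(-1) / 3\<close>, prime to 3 as for an Eisenstein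
      polynomial. Hence \<open>\<eta> + 1\<close> divides 3, and through it \<open>\<beta>\<close>;
      the cube of \<open>\<eta> + 1\<close> is in turn divisible by 3.\<close>
    define m :: int where "m = 2 + 3 * c - 6 * g"
    have m: "\<not> 3 dvd m" "m \<noteq> 0" unfolding m_def by presburger+
    define w where "w = \<eta> + 1"
    have "w \<noteq> 0" using nz by (simp add: w_def)
    have w: "loc w 0" using residue_shift[of 1] ts by (simp add: w_def)
    define v where "v = ipoly [:15, -10, 6, -3, 1:] \<eta>"
    have v1: "\<not> 3 dvd (35 :: int)" by simp
    have v: "loc v 35" unfolding v_def using loc_gen(3)[of "[:15, -10, 6, -3, 1:]"] ts by simp
    then have "v \<noteq> 0" using loc_nonzero by simp
    have y: "loc (\<eta> - 1) (- 2)" using residue_shift[of "-1"] ts by simp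
    have y1: "\<not> 3 dvd (- 2 :: int)" by simp
    have "of_int 3 / w = (- ipoly [:9 * g - 3, -1, 1, -1, 1, -1, 1:] \<eta>) / of_int m"
      using minus_one_eq(2) m \<open>w \<noteq> 0\<close> unfolding w_def[symmetric] m_def[symmetric]
      by (simp add: field_simps)
    then have three: "of_int 3 / w \<in> V"
      using V_divide[OF V_closed(4)[OF V_gen(1)] loc.of_int m(1)] by metis
    have "\<beta> = 3 * (of_int (- c) / (\<eta> - 1))"
      using beta_mult nz by (simp add: field_simps)
    then have "\<beta> / w = of_int 3 / w * (of_int (- c) / (\<eta> - 1))"
      by (metis of_int_numeral times_divide_eq_left)
    then have beta: "\<beta> / w \<in> V"
      using V_closed(3)[OF three V_divide[OF V_closed(5) y y1]] by (simp only:)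
    have "w ^ 3 / of_int 3 = (of_int 7 * (w * w) - of_int m - of_int (3 * g + 1) * w) / v"
      using minus_one_eq(1) \<open>v \<noteq> 0\<close> unfolding w_def[symmetric] m_def[symmetric] v_def[symmetric]
      by (simp add: field_simps power2_eq_square)
    moreover have "of_int 7 * (w * w) - of_int m - of_int (3 * g + 1) * w \<in> V"
      using w by (intro V_closed) (auto simp: V_def)
    ultimately have "w ^ 3 / of_int 3 \<in> V"
      using V_divide[OF _ v v1] by (simp only:)
    then show ?thesis
      using algebraic_int_has_residue[OF \<open>w \<noteq> 0\<close> w _ _ _ _ z] three beta one ts \<open>w \<noteq> 0\<close>
      by (simp add: w_def)
  next
    assume "(t, s) = (1, 0)"
    then have ts: "t = 1" "s = 0" by auto
    define y where "y = \<eta> - 1"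
    have "y \<noteq> 0" using nz by (simp add: y_def)
    have y: "loc y 0" using residue_shift[of "-1"] ts by (simp add: y_def)
    \<comment> \<open>The cofactor \<open>e\<close> of \<open>\<beta>\<close> in
      \<open>beta_factor\<close> is a unit at this point, so \<open>beta_eq\<close> expresses 3 as
      \<open>y\<^sup>2\<close> times a unit and \<open>beta_factor\<close> makes
      \<open>\<beta>\<close> a multiple of \<open>y\<close>.\<close>
    define e where "e = \<beta> - of_int (3 * g + 1) - 7 * y"
    have e: "loc e (- (3 * g + 1))" using E ts by (simp add: e_def y_def)
    have e1: "\<not> 3 dvd - (3 * g + 1)" by presburger
    have e2: "e \<noteq> 0" by (rule loc_nonzero[OF e e1])
    define v where "v = ipoly u \<eta>"
    have v1: "\<not> 3 dvd (35 :: int)" by simp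
    have v: "loc v 35" unfolding v_def using loc_gen(3)[of u] ts by (simp add: u_def)
    then have "v \<noteq> 0" using loc_nonzero by simp
    have V: "y \<in> V" "v \<in> V" "e \<in> V" using y v e by (auto simp: V_def)
    have "of_int 3 / y = y * v / e" "y\<^sup>2 / of_int 3 = e / v"
      using beta_eq e2 \<open>y \<noteq> 0\<close> \<open>v \<noteq> 0\<close> unfolding y_def[symmetric] e_def[symmetric] v_def[symmetric]
      by (simp_all add: field_simps power2_eq_square)
    moreover have "\<beta> / y = of_int (- c) * v / e"
      using beta_factor e2 \<open>y \<noteq> 0\<close> unfolding y_def[symmetric] e_def[symmetric] v_def[symmetric]
      by (simp add: field_simps)
    ultimately have "of_int 3 / y \<in> V" "y\<^sup>2 / of_int 3 \<in> V" "\<beta> / y \<in> V"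
      using V_divide[OF _ e e1] V_divide[OF _ v v1] V by (simp_all only: V_closed)
    then show ?thesis
      using algebraic_int_has_residue[OF \<open>y \<noteq> 0\<close> y _ _ _ _ z] one ts \<open>y \<noteq> 0\<close>
      by (simp add: y_def)
  next
    assume "(t, s) = (1, 1)"
    then have ts: "t = 1" "s = 1" by auto
    define y where "y = \<eta> - 1"
    have b1: "\<not> 3 dvd (1 :: int)" by simp
    have b: "loc \<beta> 1" using loc_gen ts by simp
    then have "\<beta> \<noteq> 0" using loc_nonzero by simp
    \<comment> \<open>Here \<open>\<beta>\<close> is the unit instead: \<open>y\<close> is a
      multiple of 3 by \<open>beta_mult\<close>, and then so is \<open>e\<close> by
      \<open>beta_factor\<close>.\<close>
    define e where "e = \<beta> - of_int (3 * g + 1) - 7 * y"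
    have "y / 3 = of_int (- c) / \<beta>"
      using beta_mult \<open>\<beta> \<noteq> 0\<close> by (simp add: y_def field_simps)
    then have y: "y / 3 \<in> V" using V_divide[OF V_closed(5) b b1] by (simp only:)
    have "e / 3 = of_int (- c) * (y / 3) * ipoly u \<eta> / \<beta>"
      using beta_factor \<open>\<beta> \<noteq> 0\<close> unfolding y_def[symmetric] e_def[symmetric]
      by (simp add: field_simps)
    then have "e / 3 \<in> V" using V_divide[OF _ b b1] y by (simp only: V_closed V_gen)
    moreover have "(\<beta> - 1) / 3 = e / 3 + of_int g + of_int 7 * (y / 3)"
      by (simp add: e_def y_def field_simps)
    ultimately have "(\<beta> - 1) / 3 \<in> V" using y by (simp only: V_closed)
    moreover have "loc 3 0"
      using loc.cong[OF loc.of_int[of 3], of 0] by (simp add: cong_def)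
    ultimately show ?thesis
      using algebraic_int_has_residue[of 3 1, OF _ _ _ _ _ _ z] one ts y by (simp add: y_def)
  qed
qed

text \<open>The four points are distinct modulo 3, so any two of the maps differ at
  \<open>\<eta>\<close> or at \<open>\<beta>\<close>, while only three residues are available for
  \<open>\<alpha>\<close>.\<close>

lemma not_single_generator:
  assumes R: "\<eta> \<in> R" "\<beta> \<in> R"
    and "algebraic_int \<alpha>" "n \<noteq> 0" "of_int n * \<alpha> = ipoly q \<eta>"
  shows "\<exists>z\<in>R. \<forall>q. z \<noteq> ipoly q \<alpha>"
proof (rule too_many_residue_relations)
  let ?I = "{(0, 0), (- 1, 0), (1, 0), (1, 1)} :: (int \<times> int) set"
  let ?\<rho> = "\<lambda>(t, s). residue t s"
  show "prime (3::int)" by simp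
  show "3 < int (card ?I)" by simp
  show "residue_relation 3 (?\<rho> i)" if "i \<in> ?I" for i
    using residue_relation_point that by (cases i) simp
  show "\<exists>k. ?\<rho> i \<alpha> k" if "i \<in> ?I" for i
    using residue_exists[OF _ assms(3-5)] that by (cases i) simp
  show "\<exists>z\<in>R. \<forall>k. \<not> (?\<rho> i z k \<and> ?\<rho> j z k)" if ij: "i \<in> ?I" "j \<in> ?I" "i \<noteq> j" for i j
  proof -
    obtain t s t' s' where [simp]: "i = (t, s)" "j = (t', s')" by (cases i, cases j)
    have ts: "(t, s) \<in> ?I" "(t', s') \<in> ?I" using ij by simp_all
    note unique = residue_relation.unique[OF residue_relation_point]
    have *: "[t = t'] (mod 3)" if "residue t s \<eta> k" "residue t' s' \<eta> k" for k
      using unique[OF ts(1) that(1) residue_eta[OF ts(1)]]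
        unique[OF ts(2) that(2) residue_eta[OF ts(2)]] by (simp add: cong_def)
    have **: "[s = s'] (mod 3)" if "residue t s \<beta> k" "residue t' s' \<beta> k" for k
      using unique[OF ts(1) that(1) residue_beta[OF ts(1)]]
        unique[OF ts(2) that(2) residue_beta[OF ts(2)]] by (simp add: cong_def)
    have "\<not> [t = t'] (mod 3) \<or> \<not> [s = s'] (mod 3)"
      using ts ij(3) by (auto simp: cong_def)
    then show ?thesis
      using R * ** by auto
  qed
qed

end

subsection \<open>Simple extensions of the rationals\<close>

lemma is_subfield_of_int:
  assumes "is_subfield K"
  shows "of_int n \<in> K"
proof -
  have nat: "of_nat m \<in> K" for m
    by (induction m) (use assms in \<open>auto simp: is_subfield_def\<close>)
  show ?thesis
    by (cases n) (use nat assms in \<open>auto simp: is_subfield_def simp del: of_nat_Suc\<close>)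
qed

lemma is_subfield_ipoly:
  assumes "is_subfield K" "x \<in> K"
  shows "ipoly p x \<in> K"
proof (induction p)
  case 0
  then show ?case using assms by (simp add: is_subfield_def)
next
  case (pCons c p)
  then show ?case
    using assms is_subfield_of_int[OF assms(1), of c] by (simp add: ipoly_pCons is_subfield_def)
qed

lemma is_subfield_rat_adjoin: "is_subfield (rat_adjoin \<theta>)"
  unfolding rat_adjoin_def by (rule hull_in) (simp add: is_subfield_def)

lemma rat_adjoin_gen: "\<theta> \<in> rat_adjoin \<theta>"
  unfolding rat_adjoin_def by (simp add: hull_inc)

abbreviation rpoly :: "rat poly \<Rightarrow> 'a::field_char_0 \<Rightarrow> 'a" where
  "rpoly p x \<equiv> poly (map_poly of_rat p) x"

lemma rpoly_add: "rpoly (p + q) x = rpoly p x + rpoly q x"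
  by (simp add: map_poly_hom_add of_rat_add)

lemma rpoly_mult: "rpoly (p * q) x = rpoly p x * rpoly q x"
  by (simp add: map_poly_hom_mult of_rat_add of_rat_mult)

lemma rpoly_of_int: "rpoly (map_poly of_int p) x = ipoly p x"
  by (simp add: map_poly_map_poly o_def)

lemma rpoly_clear_denominators: "\<exists>n q. n \<noteq> 0 \<and> of_int n * rpoly p x = ipoly q x"
proof (induction p)
  case 0
  show ?case by (intro exI[of _ 1] exI[of _ 0]) simp
next
  case (pCons r p)
  then obtain n q where n: "n \<noteq> 0" "of_int n * rpoly p x = ipoly q x" by blast
  obtain i j where r: "r = of_int i / of_int j" "j > 0"
    by (metis Fract_of_int_quotient quotient_of_div quotient_of_denom_pos surj_pair)
  have "of_int (n * j) * rpoly (pCons r p) x =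
      of_int (n * i) + of_int j * (x * (of_int n * rpoly p x))"
    unfolding r(1) using r(2) by (simp add: map_poly_pCons of_rat_divide field_simps)
  also have "\<dots> = ipoly (pCons (n * i) (smult j q)) x"
    unfolding n(2) by (simp add: ipoly_pCons ipoly_smult)
  finally show ?case using n(1) r(2) by (intro exI[of _ "n * j"]) auto
qed

lemma irreducible_root_bezout:
  fixes f :: "rat poly"
  assumes "irreducible f" "rpoly f \<theta> = 0" "\<not> f dvd p"
  obtains q where "rpoly q \<theta> * rpoly p \<theta> = 1"
proof -
  have "coprime p f"
    using prime_elem_imp_coprime[OF irreducible_imp_prime_elem_gcd[OF assms(1)] assms(3)]
    by (rule coprime_commute[THEN iffD1])
  then have eq: "fst (bezout_coefficients p f) * p + snd (bezout_coefficients p f) * f = 1"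
    by (simp add: bezout_coefficients_fst_snd)
  have "rpoly (fst (bezout_coefficients p f)) \<theta> * rpoly p \<theta> = 1"
    using arg_cong[OF eq, of "\<lambda>p. rpoly p \<theta>"] assms(2) by (simp add: rpoly_add rpoly_mult)
  then show ?thesis by (rule that)
qed

text \<open>By Bezout the polynomial expressions in \<open>\<theta>\<close> over the rationals
  already form a field, so they contain \<open>rat_adjoin \<theta>\<close>; it remains to clear
  denominators.\<close>

lemma rat_adjoin_fraction:
  assumes "irreducible f" "rpoly f \<theta> = 0" "z \<in> rat_adjoin \<theta>"
  shows "\<exists>n q. n \<noteq> 0 \<and> of_int n * z = ipoly q \<theta>"
proof -
  let ?R = "range (\<lambda>p. rpoly p \<theta>)"
  have "rpoly [:0, 1:] \<theta> = \<theta>" by (simp add: map_poly_pCons)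
  then have gen: "\<theta> \<in> ?R" by (metis rangeI)
  have add: "x + y \<in> ?R" and mult: "x * y \<in> ?R" if xy: "x \<in> ?R" "y \<in> ?R" for x y
  proof -
    obtain p q where pq: "x = rpoly p \<theta>" "y = rpoly q \<theta>" using xy by blast
    show "x + y \<in> ?R" unfolding pq rpoly_add[symmetric] by (rule rangeI)
    show "x * y \<in> ?R" unfolding pq rpoly_mult[symmetric] by (rule rangeI)
  qed
  have const: "of_rat c \<in> ?R" for c
    by (rule range_eqI[of _ _ "[:c:]"]) (simp add: map_poly_pCons)
  have inverse: "inverse x \<in> ?R" if x: "x \<in> ?R" for x
  proof -
    obtain p where p: "x = rpoly p \<theta>" using x by blast
    show ?thesis
    proof (cases "f dvd p")
      case True
      then obtain r where "p = f * r" by (elim dvdE)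
      then have "x = 0" using assms(2) unfolding p by (simp add: rpoly_mult)
      then show ?thesis using const[of 0] by simp
    next
      case False
      then obtain q where "rpoly q \<theta> * x = 1"
        unfolding p using irreducible_root_bezout[OF assms(1,2)] by blast
      then have "inverse x = rpoly q \<theta>"
        by (metis inverse_unique mult.commute)
      then show ?thesis by blast
    qed
  qed
  have uminus: "- x \<in> ?R" if "x \<in> ?R" for x
    using mult[OF const[of "- 1"] that] by simp
  have "0 \<in> ?R" "1 \<in> ?R"
    using const[of 0] const[of 1] by simp_all
  then have "is_subfield ?R"
    unfolding is_subfield_def by (intro conjI ballI add mult uminus inverse)
  then have "rat_adjoin \<theta> \<subseteq> ?R"
    unfolding rat_adjoin_def using gen by (intro hull_minimal) auto
  then show ?thesis
    using assms(3) rpoly_clear_denominators[of _ \<theta>] by auto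
qed

text \<open>Since \<open>f\<close> is monic, pseudo-division is genuine division over \<int>. The
  remainder vanishes at \<open>\<theta>\<close>, so the irreducible \<open>f\<close> divides it over
  the rationals, and its degree forces it to be 0.\<close>

lemma dvd_of_root:
  fixes f P :: "int poly"
  assumes "irreducible (map_poly of_int f :: rat poly)" "lead_coeff f = 1"
    and "ipoly f \<theta> = 0" "ipoly P \<theta> = 0"
  shows "f dvd P"
proof -
  obtain q r where qr: "pseudo_divmod P f = (q, r)" by (cases "pseudo_divmod P f")
  have "f \<noteq> 0" using assms(2) by auto
  from pseudo_divmod[OF this qr] have P: "P = f * q + r" and r: "r = 0 \<or> degree r < degree f"
    using assms(2) by simp_all
  have "rpoly (map_poly of_int r) \<theta> = 0"
    using arg_cong[OF P, of "\<lambda>p. ipoly p \<theta>"] assms(3,4)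
    by (simp add: rpoly_of_int ipoly_add ipoly_mult)
  moreover have "rpoly (map_poly of_int f) \<theta> = 0"
    using assms(3) by (simp add: rpoly_of_int)
  ultimately have "map_poly of_int f dvd (map_poly of_int r :: rat poly)"
    using irreducible_root_bezout[OF assms(1)] by (metis mult_zero_right zero_neq_one)
  moreover have "degree (map_poly of_int p :: rat poly) = degree p" for p
    by (rule degree_map_poly) simp
  moreover have "(map_poly of_int r :: rat poly) = 0 \<longleftrightarrow> r = 0"
    by (rule map_poly_eq_0_iff) auto
  ultimately have "r = 0"
    using r by (metis dvd_imp_degree_le not_less)
  then show ?thesis using P by simp
qed

section \<open>The substitution of \<open>- x\<close> for \<open>x\<close>\<close>

lemma ipoly_pcompose_uminus: "ipoly (P \<circ>\<^sub>p [:0, -1:]) x = ipoly P (- x)"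
  by (induction P) (simp_all add: pcompose_pCons ipoly_add ipoly_mult map_poly_pCons del: mult_pCons_left)

lemma pcompose_uminus_uminus: "P \<circ>\<^sub>p [:0, -1:] \<circ>\<^sub>p [:0, -1:] = (P :: int poly)"
  by (simp add: pcompose_assoc[symmetric] pcompose_pCons)

subsection \<open>Non-monogenicity\<close>

text \<open>A power basis would write every integral element of \<open>K\<close> as an integer
  polynomial in \<open>\<alpha>\<close>, against \<open>not_single_generator\<close>.\<close>

lemma (in septic) not_monogenic:
  assumes K: "is_subfield K" "\<eta> \<in> K"
    and frac: "\<And>z. z \<in> K \<Longrightarrow> \<exists>n q. n \<noteq> 0 \<and> of_int n * z = ipoly q \<eta>"
  shows "\<not> monogenic K"
proof
  assume "monogenic K"
  then obtain \<alpha> N where \<alpha>: "\<alpha> \<in> ring_of_integers K"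
    and basis: "ring_of_integers K = range (\<lambda>c :: nat \<Rightarrow> int. \<Sum>i<N. of_int (c i) * \<alpha> ^ i)"
    unfolding monogenic_def is_int_basis_def by blast
  obtain n q where n: "n \<noteq> 0" "of_int n * \<alpha> = ipoly q \<eta>"
    using frac[of \<alpha>] \<alpha> unfolding ring_of_integers_def by blast
  have "ipoly h \<eta> * inverse (of_int 3) \<in> K"
    using is_subfield_of_int[OF K(1), of 3] is_subfield_ipoly[OF K, of h] K(1)
    unfolding is_subfield_def by blast
  then have "\<beta> \<in> K"
    unfolding \<beta>_def divide_inverse by simp
  then have "\<eta> \<in> ring_of_integers K" "\<beta> \<in> ring_of_integers K"
    using K algebraic_int_eta algebraic_int_beta by (simp_all add: ring_of_integers_def)
  moreover have "algebraic_int \<alpha>" using \<alpha> by (simp add: ring_of_integers_def)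
  ultimately obtain z where z: "z \<in> ring_of_integers K" "\<And>q. z \<noteq> ipoly q \<alpha>"
    using not_single_generator[OF _ _ _ n] by blast
  then obtain c :: "nat \<Rightarrow> int" where "z = (\<Sum>i<N. of_int (c i) * \<alpha> ^ i)"
    using basis by blast
  then show False
    using z(2)[of "\<Sum>i<N. monom (c i) i"] by (simp add: ipoly_sum_monom)
qed

theorem corollary1p6:
  fixes a b :: int and \<theta> :: "'a::field_char_0" and K :: "'a set"
  assumes "irreducible (monom 1 7 + monom (of_int a) 1 + [:of_int b:] :: rat poly)"
    and "\<theta> ^ 7 + of_int a * \<theta> + of_int b = 0"
    and "K = rat_adjoin \<theta>"
    and "([a = 5] (mod 9) \<and> [b = 3] (mod 9)) \<or> ([a = 5] (mod 9) \<and> [b = 6] (mod 9))"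
  shows "\<not> monogenic K"
proof -
  define f :: "int poly" where "f = [:b, a, 0, 0, 0, 0, 0, 1:]"
  have f: "map_poly of_int f = (monom 1 7 + monom (of_int a) 1 + [:of_int b:] :: rat poly)"
    by (simp add: f_def map_poly_pCons monom_Suc numeral_eq_Suc monom_0)
  have irred: "irreducible (map_poly of_int f :: rat poly)"
    using assms(1) by (simp only: f)
  have root: "ipoly f \<theta> = 0"
    using assms(2) by (simp add: f_def map_poly_pCons algebra_simps power_numeral_reduce)
  have minimal: "f dvd P" if "ipoly P \<theta> = 0" for P
    using dvd_of_root[OF irred _ root that] by (simp add: f_def)
  have K: "is_subfield K" "\<theta> \<in> K"
    unfolding assms(3) by (rule is_subfield_rat_adjoin rat_adjoin_gen)+
  have frac: "\<exists>n q. n \<noteq> 0 \<and> of_int n * z = ipoly q \<theta>" if "z \<in> K" for z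
    using rat_adjoin_fraction[OF irred root[folded rpoly_of_int]] that unfolding assms(3) .
  \<comment> \<open>The class 5 modulo 9 is that of -4, the form of the linear coefficient in
    \<open>septic\<close>.\<close>
  define g where "g = (a + 4) div 9"
  have "a mod 9 = 5" and b_mod: "b mod 9 = 3 \<or> b mod 9 = 6"
    using assms(4) by (auto simp: cong_def)
  then have a: "a = 9 * g - 4"
    unfolding g_def by presburger
  show ?thesis
  proof (cases "b mod 9 = 3")
    case True
    define c where "c = (b - 3) div 9 + g"
    have b: "b = 9 * (c - g) + 3"
      using True unfolding c_def by presburger
    interpret septic c g \<theta>
      by (rule septic.intro; unfold a[symmetric] b[symmetric])
        (fact assms(2), fact minimal[unfolded f_def])
    show ?thesis using K frac by (rule not_monogenic)
  next
    case False
    \<comment> \<open>\<open>- \<theta>\<close> is a root of \<open>x ^ 7 + a * x - b\<close>, and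
      \<open>- b\<close> is 3 modulo 9 when \<open>b\<close> is 6.\<close>
    define c where "c = (- b - 3) div 9 + g"
    have b: "- b = 9 * (c - g) + 3"
      using False b_mod unfolding c_def by presburger
    interpret septic c g "- \<theta>"
    proof
      show "(- \<theta>) ^ 7 + of_int (9 * g - 4) * - \<theta> + of_int (9 * (c - g) + 3) = 0"
        unfolding a[symmetric] b[symmetric] using arg_cong[OF assms(2), of uminus] by simp
      fix P assume "ipoly P (- \<theta>) = 0"
      then have "f dvd P \<circ>\<^sub>p [:0, -1:]"
        by (intro minimal) (simp add: ipoly_pcompose_uminus)
      then obtain Q where Q: "P \<circ>\<^sub>p [:0, -1:] = f * Q" by (elim dvdE)
      \<comment> \<open>The substitution is an involution, so applying it again carries the
        divisibility by \<open>f\<close> over to \<open>f(- x)\<close>, which is minus the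
        polynomial of \<open>- \<theta>\<close>.\<close>
      have "P = f \<circ>\<^sub>p [:0, -1:] * Q \<circ>\<^sub>p [:0, -1:]"
        using arg_cong[OF Q, of "\<lambda>p. p \<circ>\<^sub>p [:0, -1:]"] by (simp add: pcompose_uminus_uminus pcompose_mult)
      moreover have "f \<circ>\<^sub>p [:0, -1:] = - [:- b, a, 0, 0, 0, 0, 0, 1:]"
        by (simp add: f_def pcompose_pCons)
      ultimately have "[:- b, a, 0, 0, 0, 0, 0, 1:] dvd P"
        by (simp only: dvd_triv_left minus_dvd_iff[symmetric, of "[:- b, a, 0, 0, 0, 0, 0, 1:]"])
      then show "[:9 * (c - g) + 3, 9 * g - 4, 0, 0, 0, 0, 0, 1:] dvd P"
        unfolding a[symmetric] b[symmetric] .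
    qed
    show ?thesis
    proof (rule not_monogenic)
      show "is_subfield K" "- \<theta> \<in> K" using K by (auto simp: is_subfield_def)
      fix z assume "z \<in> K"
      then obtain n q where "n \<noteq> 0" "of_int n * z = ipoly q \<theta>" using frac by blast
      then have "n \<noteq> 0 \<and> of_int n * z = ipoly (q \<circ>\<^sub>p [:0, -1:]) (- \<theta>)"
        by (simp add: ipoly_pcompose_uminus)
      then show "\<exists>n q. n \<noteq> 0 \<and> of_int n * z = ipoly q (- \<theta>)" by blast
    qed
  qed
qed

end
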